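(* Let $R$ be a ring, let $n$ be a positive integer, let $\sigma\colon R\to M_n(R)$ be a ring homomorphism, let $\delta\colon R\to R^n$ be a right $\sigma$-derivation and let $S_1$ be a $(\sigma,\delta)$-free skew extension of $R$ generated by $x_1,\dots,x_n$. Let $S_2$ be an $R$-ring containing elements $y_1,\dots,y_n$ such that \[ ry_j=\sum_{i=1}^n y_i\sigma_{ij}(r)+\delta_j(r),\quad\text{for all } j=1,\dots,n\text{ and } r\in R, \] and such that for any $R$-ring $A$ and elements $a_1,\dots,a_n\in A$ satisfying $ra_j=\sum_{i=1}^n a_i\sigma_{ij}(r)+\delta_j(r)$ for all $j=1,\dots,n$ and $r\in R$, there exists a unique $R$-ring homomorphism $\psi\colon S_2\to A$ such that $\psi(y_i)=a_i$ for all $i=1,\dots,n$. Then there is an $R$-ring isomorphism $S_1\to S_2$ sending $x_i$ to $y_i$ for all $i=1,\dots,n$. In particular, if $S_1$ and $S_2$ are $(\sigma,\delta)$-free skew extensions of $R$ generated by $x_1,\dots,x_n$ and $y_1,\dots,y_n$, respectively, then there exists a unique $R$-ring isomorphism $S_1\to S_2$ sending $x_i$ to $y_i$ for all $i=1,\dots,n$.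
   Context: Rings are associative with identity element; ring homomorphisms preserve the identity; modules are unital. An $R$-ring is a ring $A$ together with a ring homomorphism $\lambda_A\colon R\to A$; it is an $R$-bimodule via $ra=\lambda_A(r)a$, $ar=a\lambda_A(r)$, and in expressions inside $A$ an element $r\in R$ stands for $\lambda_A(r)$. An $R$-ring homomorphism $\varphi\colon A\to B$ is a ring homomorphism with $\varphi\lambda_A=\lambda_B$. $R^n$ denotes row vectors with $n$ entries in $R$. For a ring homomorphism $\sigma\colon R\to M_n(R)$, a right $\sigma$-derivation is an additive map $\delta\colon R\to R^n$ with $\delta(rs)=\delta(r)\sigma(s)+r\delta(s)$ for all $r,s\in R$ (matrix product in the first term). Write $\sigma_{ij}(r)$ for the $(i,j)$-entry of $\sigma(r)$ and $\delta_j(r)$ for the $j$-th component of $\delta(r)$. A $(\sigma,\delta)$-free skew extension of $R$ generated by $X=\{x_1,\dots,x_n\}$ is an $R$-ring $S$ containing an $n$-element subset $X=\{x_1,\dots,x_n\}$ such that (i) the submonoid $\langle X\rangle$ of the multiplicative monoid of $S$ generated by $X$ is free on $X$; (ii) $S$ is a free right $R$-module with basis $\langle X\rangle$; (iii) $rx_j=\sum_{i=1}^n x_i\sigma_{ij}(r)+\delta_j(r)$ for all $j=1,\dots,n$ and $r\in R$. *)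

theory Defs
  imports "HOL-Algebra.QuotRing"
begin

text \<open>
  An \<open>R\<close>-ring is a pair \<open>(A, l)\<close> with \<^term>\<open>ring_hom_ring R A l\<close>. Indices run over \<open>{1..n}\<close>; families
  of generators are functions on \<^typ>\<open>nat\<close> whose values outside \<open>{1..n}\<close> are irrelevant, while
  row vectors, matrices and maps between carriers are extensional, so that equality of HOL
  functions is equality of the objects they represent.
\<close>

definition matrix_ring :: "'r ring \<Rightarrow> nat \<Rightarrow> (nat \<times> nat \<Rightarrow> 'r) ring" where
  "matrix_ring R n =
    \<lparr>carrier = ({1..n} \<times> {1..n}) \<rightarrow>\<^sub>E carrier R,
     monoid.mult = (\<lambda>M N. \<lambda>(i, j)\<in>{1..n} \<times> {1..n}. \<Oplus>\<^bsub>R\<^esub>k\<in>{1..n}. M (i, k) \<otimes>\<^bsub>R\<^esub> N (k, j)),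
     one = (\<lambda>(i, j)\<in>{1..n} \<times> {1..n}. if i = j then \<one>\<^bsub>R\<^esub> else \<zero>\<^bsub>R\<^esub>),
     zero = (\<lambda>(i, j)\<in>{1..n} \<times> {1..n}. \<zero>\<^bsub>R\<^esub>),
     add = (\<lambda>M N. \<lambda>(i, j)\<in>{1..n} \<times> {1..n}. M (i, j) \<oplus>\<^bsub>R\<^esub> N (i, j))\<rparr>"

text \<open>The condition \<open>\<delta>(rs) = \<delta>(r)\<sigma>(s) + r\<delta>(s)\<close> in \<open>R\<^sup>n\<close> is written out entry by entry.\<close>

definition right_derivation ::
  "'r ring \<Rightarrow> nat \<Rightarrow> ('r \<Rightarrow> nat \<times> nat \<Rightarrow> 'r) \<Rightarrow> ('r \<Rightarrow> nat \<Rightarrow> 'r) \<Rightarrow> bool" where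
  "right_derivation R n \<sigma> \<delta> \<longleftrightarrow>
    \<delta> \<in> carrier R \<rightarrow> ({1..n} \<rightarrow>\<^sub>E carrier R) \<and>
    (\<forall>r\<in>carrier R. \<forall>s\<in>carrier R. \<forall>j\<in>{1..n}. \<delta> (r \<oplus>\<^bsub>R\<^esub> s) j = \<delta> r j \<oplus>\<^bsub>R\<^esub> \<delta> s j) \<and>
    (\<forall>r\<in>carrier R. \<forall>s\<in>carrier R. \<forall>j\<in>{1..n}.
      \<delta> (r \<otimes>\<^bsub>R\<^esub> s) j = (\<Oplus>\<^bsub>R\<^esub>i\<in>{1..n}. \<delta> r i \<otimes>\<^bsub>R\<^esub> \<sigma> s (i, j)) \<oplus>\<^bsub>R\<^esub> r \<otimes>\<^bsub>R\<^esub> \<delta> s j)"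

definition Rring_hom ::
  "'r ring \<Rightarrow> 'a ring \<Rightarrow> ('r \<Rightarrow> 'a) \<Rightarrow> 'b ring \<Rightarrow> ('r \<Rightarrow> 'b) \<Rightarrow> ('a \<Rightarrow> 'b) set" where
  "Rring_hom R A lA B lB =
    {\<phi> \<in> ring_hom A B. \<phi> \<in> extensional (carrier A) \<and> (\<forall>r\<in>carrier R. \<phi> (lA r) = lB r)}"

definition Rring_iso ::
  "'r ring \<Rightarrow> 'a ring \<Rightarrow> ('r \<Rightarrow> 'a) \<Rightarrow> 'b ring \<Rightarrow> ('r \<Rightarrow> 'b) \<Rightarrow> ('a \<Rightarrow> 'b) set" where
  "Rring_iso R A lA B lB = Rring_hom R A lA B lB \<inter> ring_iso A B"

definition generated_submonoid :: "('a, 'm) monoid_scheme \<Rightarrow> 'a set \<Rightarrow> 'a set" where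
  "generated_submonoid M X = \<Inter>{H. submonoid H M \<and> X \<subseteq> H}"

definition word_monoid :: "'a set \<Rightarrow> 'a list monoid" where
  "word_monoid X = \<lparr>carrier = lists X, monoid.mult = (@), one = []\<rparr>"

definition generates_freely :: "('a, 'm) monoid_scheme \<Rightarrow> 'a set \<Rightarrow> bool" where
  "generates_freely M X \<longleftrightarrow>
    (\<lambda>w. foldr (\<otimes>\<^bsub>M\<^esub>) w \<one>\<^bsub>M\<^esub>)
      \<in> iso (word_monoid X) (M\<lparr>carrier := generated_submonoid M X\<rparr>)"

text \<open>\<open>B\<close> is a basis of the \<open>R\<close>-ring \<open>(S, l)\<close> viewed as a right \<open>R\<close>-module via \<open>s \<cdot> r = s l(r)\<close>:
  linearly independent and spanning.\<close>

definition right_basis :: "'r ring \<Rightarrow> 'a ring \<Rightarrow> ('r \<Rightarrow> 'a) \<Rightarrow> 'a set \<Rightarrow> bool" where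
  "right_basis R S l B \<longleftrightarrow>
    B \<subseteq> carrier S \<and>
    (\<forall>F c. finite F \<and> F \<subseteq> B \<and> c \<in> F \<rightarrow> carrier R \<and>
        (\<Oplus>\<^bsub>S\<^esub>b\<in>F. b \<otimes>\<^bsub>S\<^esub> l (c b)) = \<zero>\<^bsub>S\<^esub> \<longrightarrow> (\<forall>b\<in>F. c b = \<zero>\<^bsub>R\<^esub>)) \<and>
    (\<forall>s\<in>carrier S. \<exists>F c. finite F \<and> F \<subseteq> B \<and> c \<in> F \<rightarrow> carrier R \<and>
        s = (\<Oplus>\<^bsub>S\<^esub>b\<in>F. b \<otimes>\<^bsub>S\<^esub> l (c b)))"

definition skew_relations ::
  "'r ring \<Rightarrow> nat \<Rightarrow> ('r \<Rightarrow> nat \<times> nat \<Rightarrow> 'r) \<Rightarrow> ('r \<Rightarrow> nat \<Rightarrow> 'r) \<Rightarrow>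
    'a ring \<Rightarrow> ('r \<Rightarrow> 'a) \<Rightarrow> (nat \<Rightarrow> 'a) \<Rightarrow> bool" where
  "skew_relations R n \<sigma> \<delta> A l a \<longleftrightarrow>
    (\<forall>j\<in>{1..n}. \<forall>r\<in>carrier R.
      l r \<otimes>\<^bsub>A\<^esub> a j = (\<Oplus>\<^bsub>A\<^esub>i\<in>{1..n}. a i \<otimes>\<^bsub>A\<^esub> l (\<sigma> r (i, j))) \<oplus>\<^bsub>A\<^esub> l (\<delta> r j))"

definition free_skew_extension ::
  "'r ring \<Rightarrow> nat \<Rightarrow> ('r \<Rightarrow> nat \<times> nat \<Rightarrow> 'r) \<Rightarrow> ('r \<Rightarrow> nat \<Rightarrow> 'r) \<Rightarrow>
    'a ring \<Rightarrow> ('r \<Rightarrow> 'a) \<Rightarrow> (nat \<Rightarrow> 'a) \<Rightarrow> bool" where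
  "free_skew_extension R n \<sigma> \<delta> S l x \<longleftrightarrow>
    ring_hom_ring R S l \<and>
    x \<in> {1..n} \<rightarrow> carrier S \<and> inj_on x {1..n} \<and>
    generates_freely S (x ` {1..n}) \<and>
    right_basis R S l (generated_submonoid S (x ` {1..n})) \<and>
    skew_relations R n \<sigma> \<delta> S l x"

text \<open>The universal property of \<open>(S, l, y)\<close>, tested against all \<open>R\<close>-rings whose carrier is a set of
  elements of \<^typ>\<open>'a\<close>. HOL cannot quantify over types inside a formula, so the type \<open>'a\<close>, the
  universe of the test rings, is a parameter.\<close>

definition universal_property ::
  "'a itself \<Rightarrow> 'r ring \<Rightarrow> nat \<Rightarrow> ('r \<Rightarrow> nat \<times> nat \<Rightarrow> 'r) \<Rightarrow> ('r \<Rightarrow> nat \<Rightarrow> 'r) \<Rightarrow>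
    's ring \<Rightarrow> ('r \<Rightarrow> 's) \<Rightarrow> (nat \<Rightarrow> 's) \<Rightarrow> bool" where
  "universal_property _ R n \<sigma> \<delta> S l y \<longleftrightarrow>
    (\<forall>(A :: 'a ring) lA a.
      ring_hom_ring R A lA \<and> a \<in> {1..n} \<rightarrow> carrier A \<and> skew_relations R n \<sigma> \<delta> A lA a \<longrightarrow>
      (\<exists>!\<psi>. \<psi> \<in> Rring_hom R S l A lA \<and> (\<forall>i\<in>{1..n}. \<psi> (y i) = a i)))"

end

theory Submission
  imports Defs
begin

text \<open>
  A free skew extension itself has the universal property; the rest is the usual uniqueness of
  universal objects. Given elements \<open>a\<^sub>i\<close> of an \<open>R\<close>-ring \<open>A\<close> that satisfy the relations, freeness
  gives an additive, right \<open>R\<close>-linear map \<open>\<psi>\<close> sending each monomial in the \<open>x\<^sub>i\<close> to the same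
  monomial in the \<open>a\<^sub>i\<close>. The elements \<open>t\<close> such that \<open>\<psi> (s t) = \<psi> s \<psi> t\<close> for all \<open>s\<close> are closed under
  sums and products and contain the image of \<open>R\<close>; by the relations they also contain the \<open>x\<^sub>j\<close>,
  hence they are all of \<open>S\<^sub>1\<close>.
\<close>

section \<open>Finite sums and right linear combinations\<close>

lemma (in abelian_group_hom) hom_finsum_additive:
  assumes "finite F" and "f \<in> F \<rightarrow> carrier G"
  shows "h (\<Oplus>\<^bsub>G\<^esub>b\<in>F. f b) = (\<Oplus>\<^bsub>H\<^esub>b\<in>F. h (f b))"
  using assms
proof (induction F rule: finite_induct)
  case (insert b F)
  have "(\<Oplus>\<^bsub>G\<^esub>b\<in>insert b F. f b) = f b \<oplus>\<^bsub>G\<^esub> (\<Oplus>\<^bsub>G\<^esub>b\<in>F. f b)"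
    using insert by (intro G.finsum_insert) auto
  moreover have "(\<Oplus>\<^bsub>H\<^esub>b\<in>insert b F. h (f b)) = h (f b) \<oplus>\<^bsub>H\<^esub> (\<Oplus>\<^bsub>H\<^esub>b\<in>F. h (f b))"
    using insert by (intro H.finsum_insert) (auto simp: Pi_iff)
  moreover have "f b \<in> carrier G" "(\<Oplus>\<^bsub>G\<^esub>b\<in>F. f b) \<in> carrier G"
    using insert.prems by (auto intro!: G.finsum_closed)
  ultimately show ?case
    using insert by auto
qed simp

text \<open>The graph of the prospective right linear map with \<open>b\<close> going to
  \<open>g b\<close>. An element has many representations, since zero coefficients may be added at
  will, so a relation is used first and shown to be single-valued afterwards; no coordinates have to
  be chosen.\<close>

definition linear_relation ::
  "'r ring \<Rightarrow> 'a ring \<Rightarrow> ('r \<Rightarrow> 'a) \<Rightarrow> 'b ring \<Rightarrow> ('r \<Rightarrow> 'b) \<Rightarrow> 'a set \<Rightarrow> ('a \<Rightarrow> 'b) \<Rightarrow> 'a \<Rightarrow> 'b \<Rightarrow> bool"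
  where
  "linear_relation R S l A m B g s t \<longleftrightarrow>
    (\<exists>F c. finite F \<and> F \<subseteq> B \<and> c \<in> F \<rightarrow> carrier R \<and>
      s = (\<Oplus>\<^bsub>S\<^esub>b\<in>F. b \<otimes>\<^bsub>S\<^esub> l (c b)) \<and> t = (\<Oplus>\<^bsub>A\<^esub>b\<in>F. g b \<otimes>\<^bsub>A\<^esub> m (c b)))"

text \<open>Padding with zero coefficients brings combinations with different supports to a common
  one. The family \<open>g\<close> is arbitrary, so that this and the next two lemmas apply both to
  the basis itself and to its prescribed images in another ring.\<close>

lemma (in ring_hom_ring) lincomb_extend:
  assumes "finite F'" "F \<subseteq> F'" "c \<in> F \<rightarrow> carrier R" "g \<in> F' \<rightarrow> carrier S"
  shows "(\<Oplus>\<^bsub>S\<^esub>b\<in>F. g b \<otimes>\<^bsub>S\<^esub> h (c b)) =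
    (\<Oplus>\<^bsub>S\<^esub>b\<in>F'. g b \<otimes>\<^bsub>S\<^esub> h (if b \<in> F then c b else \<zero>\<^bsub>R\<^esub>))"
proof (rule S.add.finprod_mono_neutral_cong_left)
  show "(\<lambda>b. g b \<otimes>\<^bsub>S\<^esub> h (if b \<in> F then c b else \<zero>)) \<in> F' \<rightarrow> carrier S"
    using assms by (auto simp: Pi_iff)
qed (use assms in \<open>auto simp: Pi_iff\<close>)

lemma (in ring_hom_ring) lincomb_add:
  assumes "c \<in> F \<rightarrow> carrier R" "d \<in> F \<rightarrow> carrier R" "g \<in> F \<rightarrow> carrier S"
  shows "(\<Oplus>\<^bsub>S\<^esub>b\<in>F. g b \<otimes>\<^bsub>S\<^esub> h (c b)) \<oplus>\<^bsub>S\<^esub> (\<Oplus>\<^bsub>S\<^esub>b\<in>F. g b \<otimes>\<^bsub>S\<^esub> h (d b)) =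
    (\<Oplus>\<^bsub>S\<^esub>b\<in>F. g b \<otimes>\<^bsub>S\<^esub> h (c b \<oplus>\<^bsub>R\<^esub> d b))"
proof -
  have "(\<Oplus>\<^bsub>S\<^esub>b\<in>F. g b \<otimes>\<^bsub>S\<^esub> h (c b)) \<oplus>\<^bsub>S\<^esub> (\<Oplus>\<^bsub>S\<^esub>b\<in>F. g b \<otimes>\<^bsub>S\<^esub> h (d b)) =
      (\<Oplus>\<^bsub>S\<^esub>b\<in>F. g b \<otimes>\<^bsub>S\<^esub> h (c b) \<oplus>\<^bsub>S\<^esub> g b \<otimes>\<^bsub>S\<^esub> h (d b))"
    by (rule S.finsum_addf[symmetric]) (use assms in \<open>auto simp: Pi_iff\<close>)
  also have "\<dots> = (\<Oplus>\<^bsub>S\<^esub>b\<in>F. g b \<otimes>\<^bsub>S\<^esub> h (c b \<oplus>\<^bsub>R\<^esub> d b))"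
    by (rule S.finsum_cong') (use assms in \<open>auto simp: Pi_iff S.r_distr\<close>)
  finally show ?thesis .
qed

lemma (in ring_hom_ring) lincomb_right_mult:
  assumes "finite F" "c \<in> F \<rightarrow> carrier R" "r \<in> carrier R" "g \<in> F \<rightarrow> carrier S"
  shows "(\<Oplus>\<^bsub>S\<^esub>b\<in>F. g b \<otimes>\<^bsub>S\<^esub> h (c b)) \<otimes>\<^bsub>S\<^esub> h r = (\<Oplus>\<^bsub>S\<^esub>b\<in>F. g b \<otimes>\<^bsub>S\<^esub> h (c b \<otimes>\<^bsub>R\<^esub> r))"
proof -
  have "(\<Oplus>\<^bsub>S\<^esub>b\<in>F. g b \<otimes>\<^bsub>S\<^esub> h (c b)) \<otimes>\<^bsub>S\<^esub> h r = (\<Oplus>\<^bsub>S\<^esub>b\<in>F. g b \<otimes>\<^bsub>S\<^esub> h (c b) \<otimes>\<^bsub>S\<^esub> h r)"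
    by (rule S.finsum_ldistr) (use assms in \<open>auto simp: Pi_iff\<close>)
  also have "\<dots> = (\<Oplus>\<^bsub>S\<^esub>b\<in>F. g b \<otimes>\<^bsub>S\<^esub> h (c b \<otimes>\<^bsub>R\<^esub> r))"
    by (rule S.finsum_cong') (use assms in \<open>auto simp: Pi_iff S.m_assoc\<close>)
  finally show ?thesis .
qed

text \<open>Used to check additive statements on a single basis element with a single coefficient;
  the terms of one representation of \<open>s\<close> are peeled off one by one.\<close>

lemma right_basis_induct [consumes 3, case_names zero add monomial]:
  assumes "ring_hom_ring R S l" and "right_basis R S l B" and "s \<in> carrier S"
    and zero: "P \<zero>\<^bsub>S\<^esub>"
    and add: "\<And>s t. s \<in> carrier S \<Longrightarrow> t \<in> carrier S \<Longrightarrow> P s \<Longrightarrow> P t \<Longrightarrow> P (s \<oplus>\<^bsub>S\<^esub> t)"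
    and monomial: "\<And>b r. b \<in> B \<Longrightarrow> r \<in> carrier R \<Longrightarrow> P (b \<otimes>\<^bsub>S\<^esub> l r)"
  shows "P s"
proof -
  interpret ring_hom_ring R S l by fact
  have B: "B \<subseteq> carrier S"
    using assms(2) by (auto simp: right_basis_def)
  obtain F c where F: "finite F" "F \<subseteq> B" "c \<in> F \<rightarrow> carrier R"
    and s: "s = (\<Oplus>\<^bsub>S\<^esub>b\<in>F. b \<otimes>\<^bsub>S\<^esub> l (c b))"
    using assms(2,3) unfolding right_basis_def by meson
  have "P (\<Oplus>\<^bsub>S\<^esub>b\<in>F. b \<otimes>\<^bsub>S\<^esub> l (c b))"
    using F
  proof (induction F rule: finite_induct)
    case (insert b F)
    have closed: "(\<lambda>b. b \<otimes>\<^bsub>S\<^esub> l (c b)) \<in> F \<rightarrow> carrier S" "b \<otimes>\<^bsub>S\<^esub> l (c b) \<in> carrier S"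
      using insert.prems B by (auto simp: Pi_iff)
    have "(\<Oplus>\<^bsub>S\<^esub>b\<in>insert b F. b \<otimes>\<^bsub>S\<^esub> l (c b)) =
        b \<otimes>\<^bsub>S\<^esub> l (c b) \<oplus>\<^bsub>S\<^esub> (\<Oplus>\<^bsub>S\<^esub>b\<in>F. b \<otimes>\<^bsub>S\<^esub> l (c b))"
      using insert.hyps closed by (rule S.finsum_insert)
    moreover have "P \<dots>"
      using insert closed by (intro add monomial) auto
    ultimately show ?case by simp
  qed (simp add: zero)
  then show ?thesis using s by simp
qed

section \<open>Right linear extension of a map given on a basis\<close>

locale linear_extension =
  src: ring_hom_ring R S l + tgt: ring_hom_ring R A m
  for R :: "'r ring" and S :: "'a ring" and l and A :: "'b ring" and m +
  fixes B and g
  assumes basis: "right_basis R S l B"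
    and g_closed: "g \<in> B \<rightarrow> carrier A"
begin

abbreviation rel :: "'a \<Rightarrow> 'b \<Rightarrow> bool" where
  "rel \<equiv> linear_relation R S l A m B g"

lemma B_subset: "B \<subseteq> carrier S"
  using basis by (simp add: right_basis_def)

lemma rel_closed:
  assumes "rel s t"
  shows "s \<in> carrier S" and "t \<in> carrier A"
proof -
  obtain F c where F: "F \<subseteq> B" "c \<in> F \<rightarrow> carrier R"
    and s: "s = (\<Oplus>\<^bsub>S\<^esub>b\<in>F. b \<otimes>\<^bsub>S\<^esub> l (c b))" and t: "t = (\<Oplus>\<^bsub>A\<^esub>b\<in>F. g b \<otimes>\<^bsub>A\<^esub> m (c b))"
    using assms unfolding linear_relation_def by blast
  have "b \<in> carrier S" "g b \<in> carrier A" "c b \<in> carrier R" if "b \<in> F" for b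
    using that F B_subset g_closed by auto
  then show "s \<in> carrier S" and "t \<in> carrier A"
    unfolding s t by (simp_all add: Pi_iff)
qed

lemma rel_total:
  assumes "s \<in> carrier S"
  shows "\<exists>t. rel s t"
proof -
  obtain F c where F: "finite F" "F \<subseteq> B" "c \<in> F \<rightarrow> carrier R"
    "s = (\<Oplus>\<^bsub>S\<^esub>b\<in>F. b \<otimes>\<^bsub>S\<^esub> l (c b))"
    using assms basis unfolding right_basis_def by meson
  have "rel s (\<Oplus>\<^bsub>A\<^esub>b\<in>F. g b \<otimes>\<^bsub>A\<^esub> m (c b))"
    unfolding linear_relation_def by (intro exI[of _ F] exI[of _ c] conjI F refl)
  then show ?thesis ..
qed

lemma rel_add:
  assumes "rel s t" and "rel s' t'"
  shows "rel (s \<oplus>\<^bsub>S\<^esub> s') (t \<oplus>\<^bsub>A\<^esub> t')"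
proof -
  obtain F c where F: "finite F" "F \<subseteq> B" "c \<in> F \<rightarrow> carrier R"
    "s = (\<Oplus>\<^bsub>S\<^esub>b\<in>F. b \<otimes>\<^bsub>S\<^esub> l (c b))" "t = (\<Oplus>\<^bsub>A\<^esub>b\<in>F. g b \<otimes>\<^bsub>A\<^esub> m (c b))"
    using assms(1) unfolding linear_relation_def by blast
  obtain F' c' where F': "finite F'" "F' \<subseteq> B" "c' \<in> F' \<rightarrow> carrier R"
    "s' = (\<Oplus>\<^bsub>S\<^esub>b\<in>F'. b \<otimes>\<^bsub>S\<^esub> l (c' b))" "t' = (\<Oplus>\<^bsub>A\<^esub>b\<in>F'. g b \<otimes>\<^bsub>A\<^esub> m (c' b))"
    using assms(2) unfolding linear_relation_def by blast
  let ?G = "F \<union> F'"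
  \<comment> \<open>The same padded coefficients \<open>d\<close> and \<open>d'\<close> serve in
    \<open>S\<close> and in \<open>A\<close>; their sum is therefore one witness for both sides of
    the relation.\<close>
  define d where "d b = (if b \<in> F then c b else \<zero>\<^bsub>R\<^esub>)" for b
  define d' where "d' b = (if b \<in> F' then c' b else \<zero>\<^bsub>R\<^esub>)" for b
  have G: "finite ?G" "F \<subseteq> ?G" "F' \<subseteq> ?G" "?G \<subseteq> B"
    using F F' by auto
  have d: "d \<in> ?G \<rightarrow> carrier R" "d' \<in> ?G \<rightarrow> carrier R"
    using F(3) F'(3) by (auto simp: d_def d'_def Pi_iff)
  have id: "(\<lambda>b. b) \<in> ?G \<rightarrow> carrier S" and g: "g \<in> ?G \<rightarrow> carrier A"
    using G B_subset g_closed by auto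
  have "s = (\<Oplus>\<^bsub>S\<^esub>b\<in>?G. b \<otimes>\<^bsub>S\<^esub> l (d b))" "s' = (\<Oplus>\<^bsub>S\<^esub>b\<in>?G. b \<otimes>\<^bsub>S\<^esub> l (d' b))"
    using src.lincomb_extend[OF G(1,2) F(3) id] src.lincomb_extend[OF G(1,3) F'(3) id] F(4) F'(4)
    by (simp_all add: d_def d'_def)
  then have s: "s \<oplus>\<^bsub>S\<^esub> s' = (\<Oplus>\<^bsub>S\<^esub>b\<in>?G. b \<otimes>\<^bsub>S\<^esub> l (d b \<oplus>\<^bsub>R\<^esub> d' b))"
    using src.lincomb_add[OF d id] by simp
  have "t = (\<Oplus>\<^bsub>A\<^esub>b\<in>?G. g b \<otimes>\<^bsub>A\<^esub> m (d b))" "t' = (\<Oplus>\<^bsub>A\<^esub>b\<in>?G. g b \<otimes>\<^bsub>A\<^esub> m (d' b))"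
    using tgt.lincomb_extend[OF G(1,2) F(3) g] tgt.lincomb_extend[OF G(1,3) F'(3) g] F(5) F'(5)
    by (simp_all add: d_def d'_def)
  then have t: "t \<oplus>\<^bsub>A\<^esub> t' = (\<Oplus>\<^bsub>A\<^esub>b\<in>?G. g b \<otimes>\<^bsub>A\<^esub> m (d b \<oplus>\<^bsub>R\<^esub> d' b))"
    using tgt.lincomb_add[OF d g] by simp
  have "(\<lambda>b. d b \<oplus>\<^bsub>R\<^esub> d' b) \<in> ?G \<rightarrow> carrier R"
    using d by (auto simp: Pi_iff)
  then show ?thesis
    unfolding linear_relation_def using s t G by blast
qed

lemma rel_right_mult:
  assumes "rel s t" and r: "r \<in> carrier R"
  shows "rel (s \<otimes>\<^bsub>S\<^esub> l r) (t \<otimes>\<^bsub>A\<^esub> m r)"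
proof -
  obtain F c where F: "finite F" "F \<subseteq> B" "c \<in> F \<rightarrow> carrier R"
    and st: "s = (\<Oplus>\<^bsub>S\<^esub>b\<in>F. b \<otimes>\<^bsub>S\<^esub> l (c b))" "t = (\<Oplus>\<^bsub>A\<^esub>b\<in>F. g b \<otimes>\<^bsub>A\<^esub> m (c b))"
    using assms(1) unfolding linear_relation_def by blast
  have "(\<lambda>b. b) \<in> F \<rightarrow> carrier S" and "g \<in> F \<rightarrow> carrier A"
    using F B_subset g_closed by auto
  then have "s \<otimes>\<^bsub>S\<^esub> l r = (\<Oplus>\<^bsub>S\<^esub>b\<in>F. b \<otimes>\<^bsub>S\<^esub> l (c b \<otimes>\<^bsub>R\<^esub> r))"
    "t \<otimes>\<^bsub>A\<^esub> m r = (\<Oplus>\<^bsub>A\<^esub>b\<in>F. g b \<otimes>\<^bsub>A\<^esub> m (c b \<otimes>\<^bsub>R\<^esub> r))"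
    using src.lincomb_right_mult[OF F(1,3) r] tgt.lincomb_right_mult[OF F(1,3) r] st by blast+
  moreover have "(\<lambda>b. c b \<otimes>\<^bsub>R\<^esub> r) \<in> F \<rightarrow> carrier R"
    using F(3) r by (auto simp: Pi_iff)
  ultimately show ?thesis
    unfolding linear_relation_def using F by blast
qed

lemma rel_basis:
  assumes "b \<in> B"
  shows "rel b (g b)"
  unfolding linear_relation_def
proof (intro exI conjI)
  have "b \<in> carrier S" "g b \<in> carrier A"
    using assms B_subset g_closed by auto
  then show "b = (\<Oplus>\<^bsub>S\<^esub>b\<in>{b}. b \<otimes>\<^bsub>S\<^esub> l \<one>\<^bsub>R\<^esub>)" "g b = (\<Oplus>\<^bsub>A\<^esub>b\<in>{b}. g b \<otimes>\<^bsub>A\<^esub> m \<one>\<^bsub>R\<^esub>)"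
    by simp_all
qed (use assms in auto)

text \<open>Linear independence enters here: all coefficients of a representation of zero vanish,
  and with them all terms of \<open>t\<close>.\<close>

lemma rel_zero_left:
  assumes "rel \<zero>\<^bsub>S\<^esub> t"
  shows "t = \<zero>\<^bsub>A\<^esub>"
proof -
  obtain F c where F: "finite F" "F \<subseteq> B" "c \<in> F \<rightarrow> carrier R"
    "(\<Oplus>\<^bsub>S\<^esub>b\<in>F. b \<otimes>\<^bsub>S\<^esub> l (c b)) = \<zero>\<^bsub>S\<^esub>" and t: "t = (\<Oplus>\<^bsub>A\<^esub>b\<in>F. g b \<otimes>\<^bsub>A\<^esub> m (c b))"
    using assms unfolding linear_relation_def by metis
  then have "\<forall>b\<in>F. c b = \<zero>\<^bsub>R\<^esub>"
    using basis unfolding right_basis_def by blast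
  then have "t = (\<Oplus>\<^bsub>A\<^esub>b\<in>F. \<zero>\<^bsub>A\<^esub>)"
    unfolding t using F(2) g_closed by (intro tgt.S.finsum_cong') (auto simp: Pi_iff subset_iff)
  then show ?thesis by simp
qed

text \<open>An additive relation on groups is single-valued once zero is related only to zero. Any
  value \<open>u\<close> at the negative of \<open>s\<close> is a common additive inverse of
  \<open>t\<close> and \<open>t'\<close>, so representations need not be compared.\<close>

lemma rel_unique:
  assumes "rel s t" and "rel s t'"
  shows "t = t'"
proof -
  have closed: "s \<in> carrier S" "t \<in> carrier A" "t' \<in> carrier A"
    using rel_closed[OF assms(1)] rel_closed[OF assms(2)] by simp_all
  obtain u where u: "rel (\<ominus>\<^bsub>S\<^esub> s) u"
    using rel_total closed by blast
  have "s \<oplus>\<^bsub>S\<^esub> \<ominus>\<^bsub>S\<^esub> s = \<zero>\<^bsub>S\<^esub>"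
    using closed by (simp add: src.S.r_neg)
  then have "t \<oplus>\<^bsub>A\<^esub> u = \<zero>\<^bsub>A\<^esub>" "t' \<oplus>\<^bsub>A\<^esub> u = \<zero>\<^bsub>A\<^esub>"
    using rel_add[OF assms(1) u] rel_add[OF assms(2) u] by (metis rel_zero_left)+
  then have "t \<oplus>\<^bsub>A\<^esub> u = t' \<oplus>\<^bsub>A\<^esub> u"
    by simp
  then show ?thesis
    using closed rel_closed[OF u] by simp
qed

text \<open>The description is proper by \<open>rel_total\<close> and \<open>rel_unique\<close>. The
  restriction to the carrier is there because members of \<open>Rring_hom\<close> are
  extensional.\<close>

definition extension :: "'a \<Rightarrow> 'b" where
  "extension = (\<lambda>s\<in>carrier S. THE t. rel s t)"

lemma extension_extensional: "extension \<in> extensional (carrier S)"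
  by (simp add: extension_def)

lemma extension_eq:
  assumes "rel s t"
  shows "extension s = t"
proof -
  have "(THE t. rel s t) = t"
    using assms rel_unique by (intro the_equality) blast+
  then show ?thesis
    using rel_closed[OF assms] by (simp add: extension_def)
qed

lemma rel_extension: "s \<in> carrier S \<Longrightarrow> rel s (extension s)"
  using rel_total extension_eq by blast

lemma extension_closed [simp]: "s \<in> carrier S \<Longrightarrow> extension s \<in> carrier A"
  using rel_extension rel_closed by blast

lemma extension_add:
  "s \<in> carrier S \<Longrightarrow> s' \<in> carrier S \<Longrightarrow> extension (s \<oplus>\<^bsub>S\<^esub> s') = extension s \<oplus>\<^bsub>A\<^esub> extension s'"
  by (intro extension_eq rel_add rel_extension)

lemma extension_right_mult:
  "s \<in> carrier S \<Longrightarrow> r \<in> carrier R \<Longrightarrow> extension (s \<otimes>\<^bsub>S\<^esub> l r) = extension s \<otimes>\<^bsub>A\<^esub> m r"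
  by (intro extension_eq rel_right_mult rel_extension)

lemma extension_basis: "b \<in> B \<Longrightarrow> extension b = g b"
  by (intro extension_eq rel_basis)

text \<open>This form makes \<open>hom_finsum_additive\<close> available for moving the map through
  the sums in the skew relations.\<close>

lemma extension_group_hom: "abelian_group_hom S A extension"
proof (rule abelian_group_homI)
  show "group_hom (add_monoid S) (add_monoid A) extension"
    by (intro group_hom.intro group_hom_axioms.intro homI src.S.add.group_axioms
        tgt.S.add.group_axioms) (simp_all add: extension_add)
qed (rule src.S.abelian_group_axioms tgt.S.abelian_group_axioms)+

end

section \<open>Monomials in free generators\<close>

lemma submonoid_generated_submonoid:
  assumes "monoid M" and "X \<subseteq> carrier M"
  shows "submonoid (generated_submonoid M X) M"
proof -
  interpret monoid M by fact
  \<comment> \<open>The family being intersected is thus nonempty, which keeps the intersection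
    inside the carrier.\<close>
  have "submonoid (carrier M) M"
    by unfold_locales auto
  then show ?thesis
    unfolding generated_submonoid_def using assms(2) by (unfold_locales) (auto simp: submonoid_def)
qed

lemma generated_submonoid_incl: "X \<subseteq> generated_submonoid M X"
  by (auto simp: generated_submonoid_def)

lemma generated_submonoid_minimal:
  "submonoid H M \<Longrightarrow> X \<subseteq> H \<Longrightarrow> generated_submonoid M X \<subseteq> H"
  by (auto simp: generated_submonoid_def)

lemma (in monoid) foldr_mult_closed:
  "set w \<subseteq> carrier G \<Longrightarrow> foldr (\<otimes>) w \<one> \<in> carrier G"
  by (induction w) auto

text \<open>The appended letter lands innermost in \<open>foldr\<close>; associativity moves it out.
  Monomials will be lengthened on the right, whereas \<open>foldr\<close> peels letters off on the
  left.\<close>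

lemma (in monoid) foldr_mult_snoc:
  "set w \<subseteq> carrier G \<Longrightarrow> z \<in> carrier G \<Longrightarrow>
    foldr (\<otimes>) (w @ [z]) \<one> = foldr (\<otimes>) w \<one> \<otimes> z"
  using foldr_mult_closed by (induction w) (auto simp: m_assoc)

text \<open>By freeness each monomial is spelled by exactly one word, and \<open>g\<close> evaluates
  that word in \<open>N\<close> after renaming its letters by \<open>f\<close>. The conclusion is
  phrased for right multiplication by one generator, the form in which the skew relations are
  applied.\<close>

lemma generates_freely_extend:
  fixes M (structure) and N (structure)
  assumes "monoid M" and "monoid N" and X: "X \<subseteq> carrier M"
    and free: "generates_freely M X" and f: "f \<in> X \<rightarrow> carrier N"
  obtains g where "g \<in> generated_submonoid M X \<rightarrow> carrier N" and "g \<one>\<^bsub>M\<^esub> = \<one>\<^bsub>N\<^esub>"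
    and "\<And>b z. b \<in> generated_submonoid M X \<Longrightarrow> z \<in> X \<Longrightarrow> g (b \<otimes>\<^bsub>M\<^esub> z) = g b \<otimes>\<^bsub>N\<^esub> f z"
proof -
  interpret M: monoid M by fact
  interpret N: monoid N by fact
  let ?ev = "\<lambda>w. foldr (\<otimes>\<^bsub>M\<^esub>) w \<one>\<^bsub>M\<^esub>"
  \<comment> \<open>The word spelling a monomial; injectivity of \<open>?ev\<close> on words makes
    this a left inverse of evaluation, see \<open>W\<close>.\<close>
  let ?W = "inv_into (lists X) ?ev"
  define g where "g b = foldr (\<otimes>\<^bsub>N\<^esub>) (map f (?W b)) \<one>\<^bsub>N\<^esub>" for b
  have bij: "bij_betw ?ev (lists X) (generated_submonoid M X)"
    using free by (auto simp: generates_freely_def iso_def word_monoid_def)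
  have W: "?W (?ev w) = w" if "w \<in> lists X" for w
    using that bij by (intro inv_into_f_f) (auto simp: bij_betw_def)
  have fw: "set (map f w) \<subseteq> carrier N" if "w \<in> lists X" for w
    using that f by auto
  show thesis
  proof
    show "g \<in> generated_submonoid M X \<rightarrow> carrier N"
    proof
      fix b assume "b \<in> generated_submonoid M X"
      then have "?W b \<in> lists X"
        using bij by (metis bij_betw_def inv_into_into)
      then show "g b \<in> carrier N"
        unfolding g_def by (intro N.foldr_mult_closed fw)
    qed
    show "g \<one>\<^bsub>M\<^esub> = \<one>\<^bsub>N\<^esub>"
      using W[of "[]"] by (simp add: g_def)
    fix b z assume b: "b \<in> generated_submonoid M X" and z: "z \<in> X"
    obtain w where w: "w \<in> lists X" "b = ?ev w"
      using b bij by (auto simp: bij_betw_def)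
    have "b \<otimes>\<^bsub>M\<^esub> z = ?ev (w @ [z])"
      using w z X by (subst M.foldr_mult_snoc) auto
    moreover have "w @ [z] \<in> lists X"
      using w z by auto
    ultimately have "?W (b \<otimes>\<^bsub>M\<^esub> z) = w @ [z]"
      using W by metis
    then have "g (b \<otimes>\<^bsub>M\<^esub> z) = foldr (\<otimes>\<^bsub>N\<^esub>) (map f w @ [f z]) \<one>\<^bsub>N\<^esub>"
      by (simp add: g_def)
    also have "\<dots> = foldr (\<otimes>\<^bsub>N\<^esub>) (map f w) \<one>\<^bsub>N\<^esub> \<otimes>\<^bsub>N\<^esub> f z"
      using z f w fw by (intro N.foldr_mult_snoc) auto
    finally show "g (b \<otimes>\<^bsub>M\<^esub> z) = g b \<otimes>\<^bsub>N\<^esub> f z"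
      using W w by (simp add: g_def)
  qed
qed

section \<open>Homomorphisms out of a free skew extension\<close>

text \<open>The set where the two maps agree is a submonoid containing \<open>X\<close>, hence
  contains the basis. They also agree on the image of \<open>R\<close>, so they agree on all
  combinations, and extensionality turns this into equality of functions.\<close>

lemma Rring_hom_unique:
  assumes "ring_hom_ring R S l" and "ring A"
    and basis: "right_basis R S l (generated_submonoid S X)" and X: "X \<subseteq> carrier S"
    and \<phi>: "\<phi> \<in> Rring_hom R S l A m" and \<psi>: "\<psi> \<in> Rring_hom R S l A m"
    and eq: "\<And>z. z \<in> X \<Longrightarrow> \<phi> z = \<psi> z"
  shows "\<phi> = \<psi>"
proof -
  interpret ring_hom_ring R S l by fact
  interpret \<phi>: ring_hom_ring S A \<phi>
    using \<phi> assms(2) by (intro ring_hom_ringI2 S.ring_axioms) (auto simp: Rring_hom_def)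
  interpret \<psi>: ring_hom_ring S A \<psi>
    using \<psi> assms(2) by (intro ring_hom_ringI2 S.ring_axioms) (auto simp: Rring_hom_def)
  have "submonoid {s \<in> carrier S. \<phi> s = \<psi> s} S"
    by unfold_locales auto
  then have gen: "b \<in> carrier S \<and> \<phi> b = \<psi> b" if "b \<in> generated_submonoid S X" for b
    using generated_submonoid_minimal[of "{s \<in> carrier S. \<phi> s = \<psi> s}" S X] X eq that by blast
  have lr: "\<phi> (l r) = \<psi> (l r)" if "r \<in> carrier R" for r
    using that \<phi> \<psi> by (simp add: Rring_hom_def)
  have "\<phi> s = \<psi> s" if "s \<in> carrier S" for s
    using assms(1) basis that by (induction rule: right_basis_induct) (auto simp: gen lr)
  then show ?thesis
    using \<phi> \<psi> by (intro extensionalityI[of _ "carrier S"]) (auto simp: Rring_hom_def)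
qed

lemma free_skew_extension_hom_exists:
  fixes S :: "'s ring" and A :: "'a ring"
  assumes \<sigma>: "\<sigma> \<in> carrier R \<rightarrow> ({1..n} \<times> {1..n} \<rightarrow> carrier R)"
    and \<delta>: "\<delta> \<in> carrier R \<rightarrow> ({1..n} \<rightarrow> carrier R)"
    and free: "free_skew_extension R n \<sigma> \<delta> S l x"
    and A: "ring_hom_ring R A m" and a: "a \<in> {1..n} \<rightarrow> carrier A"
    and rel_a: "skew_relations R n \<sigma> \<delta> A m a"
  shows "\<exists>\<psi>. \<psi> \<in> Rring_hom R S l A m \<and> (\<forall>i\<in>{1..n}. \<psi> (x i) = a i)"
proof -
  define X where "X = x ` {1..n}"
  define B where "B = generated_submonoid S X"
  have S: "ring_hom_ring R S l" and x: "x \<in> {1..n} \<rightarrow> carrier S" and inj: "inj_on x {1..n}"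
    and freely: "generates_freely S X" and basis: "right_basis R S l B"
    and rel_x: "skew_relations R n \<sigma> \<delta> S l x"
    using free by (simp_all add: free_skew_extension_def X_def B_def)
  interpret src: ring_hom_ring R S l by fact
  interpret tgt: ring_hom_ring R A m by fact
  \<comment> \<open>Freeness concerns the set \<open>X\<close>, while \<open>a\<close> is indexed by
    numbers; injectivity of \<open>x\<close> lets the values be transported to
    \<open>X\<close>.\<close>
  define f where "f = a \<circ> inv_into {1..n} x"
  have X: "X \<subseteq> carrier S" using x by (auto simp: X_def)
  have fx: "f (x i) = a i" if "i \<in> {1..n}" for i
    using that inj by (simp add: f_def)
  then have f: "f \<in> X \<rightarrow> carrier A"
    using a by (auto simp: X_def)
  obtain g where g: "g \<in> B \<rightarrow> carrier A" and g1: "g \<one>\<^bsub>S\<^esub> = \<one>\<^bsub>A\<^esub>"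
    and gz: "\<And>b z. b \<in> B \<Longrightarrow> z \<in> X \<Longrightarrow> g (b \<otimes>\<^bsub>S\<^esub> z) = g b \<otimes>\<^bsub>A\<^esub> f z"
    using generates_freely_extend[OF src.S.monoid_axioms tgt.S.monoid_axioms X freely f]
    unfolding B_def by blast
  interpret linear_extension R S l A m B g
    by unfold_locales (fact basis g)+
  interpret ext: abelian_group_hom S A extension
    by (rule extension_group_hom)
  interpret B: submonoid B S
    unfolding B_def by (intro submonoid_generated_submonoid src.S.monoid_axioms X)
  have gx: "g (b \<otimes>\<^bsub>S\<^esub> x i) = g b \<otimes>\<^bsub>A\<^esub> a i" if "b \<in> B" "i \<in> {1..n}" for b i
    using gz[of b "x i"] fx that by (simp add: X_def)
  have Bx: "b \<otimes>\<^bsub>S\<^esub> x i \<in> B" if "b \<in> B" "i \<in> {1..n}" for b i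
  proof (rule B.m_closed)
    show "x i \<in> B"
      using that(2) generated_submonoid_incl[of X S] by (auto simp: B_def X_def)
  qed (rule that)
  \<comment> \<open>The unit is the empty monomial and so itself a basis element.\<close>
  have one: "extension \<one>\<^bsub>S\<^esub> = \<one>\<^bsub>A\<^esub>"
    using g1 by (simp add: extension_basis)
  have ext_l: "extension (l r) = m r" if "r \<in> carrier R" for r
    using extension_right_mult[of "\<one>\<^bsub>S\<^esub>" r] that one by simp
  have ext_x: "extension (x i) = a i" if "i \<in> {1..n}" for i
  proof -
    have "x i \<in> carrier S" "a i \<in> carrier A" using that x a by auto
    then show ?thesis
      using gx[of "\<one>\<^bsub>S\<^esub>" i] Bx[of "\<one>\<^bsub>S\<^esub>" i] that g1 by (simp add: extension_basis)
  qed
  \<comment> \<open>Both sides are additive in \<open>s\<close>, which leaves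
    \<open>s = b \<otimes> l r\<close>. There the coefficient \<open>r\<close> stands between
    \<open>b\<close> and \<open>x j\<close>; \<open>rel_x\<close> moves it to the right, leaving the
    monomials \<open>b \<otimes> x i\<close> with coefficients \<open>\<sigma> r (i, j)\<close> and
    \<open>b\<close> with coefficient \<open>\<delta> r j\<close>. On such terms right linearity
    gives the value.\<close>
  have mult_x: "extension (s \<otimes>\<^bsub>S\<^esub> x j) = extension s \<otimes>\<^bsub>A\<^esub> a j"
    if s: "s \<in> carrier S" and j: "j \<in> {1..n}" for s j
    using S basis s
  proof (induction rule: right_basis_induct)
    case zero
    then show ?case using j x a by (auto simp: Pi_iff)
  next
    case (add s t)
    moreover have "x j \<in> carrier S" "a j \<in> carrier A" using j x a by auto
    ultimately show ?case
      by (simp add: src.S.l_distr tgt.S.l_distr extension_add)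
  next
    case (monomial b r)
    have b: "b \<in> carrier S" "g b \<in> carrier A"
      using monomial B.subset g by auto
    have xj: "x j \<in> carrier S" "a j \<in> carrier A" using j x a by auto
    have xi: "\<And>i. i \<in> {1..n} \<Longrightarrow> x i \<in> carrier S" "\<And>i. i \<in> {1..n} \<Longrightarrow> a i \<in> carrier A"
      using x a by auto
    have \<sigma>r: "\<And>i. i \<in> {1..n} \<Longrightarrow> \<sigma> r (i, j) \<in> carrier R"
      using \<sigma> monomial(2) j by (auto simp: Pi_iff)
    have \<delta>r: "\<delta> r j \<in> carrier R"
      using \<delta> monomial(2) j by (auto simp: Pi_iff)
    have sumS: "(\<Oplus>\<^bsub>S\<^esub>i\<in>{1..n}. x i \<otimes>\<^bsub>S\<^esub> l (\<sigma> r (i, j))) \<in> carrier S"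
      and sumA: "(\<Oplus>\<^bsub>A\<^esub>i\<in>{1..n}. a i \<otimes>\<^bsub>A\<^esub> m (\<sigma> r (i, j))) \<in> carrier A"
      using xi \<sigma>r by (auto intro!: src.S.finsum_closed tgt.S.finsum_closed)
    have sumS': "(\<Oplus>\<^bsub>S\<^esub>i\<in>{1..n}. b \<otimes>\<^bsub>S\<^esub> (x i \<otimes>\<^bsub>S\<^esub> l (\<sigma> r (i, j)))) \<in> carrier S"
      using xi \<sigma>r b by (auto intro!: src.S.finsum_closed)
    have ext_term: "extension (b \<otimes>\<^bsub>S\<^esub> (x i \<otimes>\<^bsub>S\<^esub> l (\<sigma> r (i, j)))) = g b \<otimes>\<^bsub>A\<^esub> (a i \<otimes>\<^bsub>A\<^esub> m (\<sigma> r (i, j)))"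
      if "i \<in> {1..n}" for i
    proof -
      have "extension (b \<otimes>\<^bsub>S\<^esub> x i \<otimes>\<^bsub>S\<^esub> l (\<sigma> r (i, j))) = g b \<otimes>\<^bsub>A\<^esub> a i \<otimes>\<^bsub>A\<^esub> m (\<sigma> r (i, j))"
        using that xi \<sigma>r b monomial(1) Bx gx by (simp add: extension_right_mult extension_basis)
      then show ?thesis
        using that xi \<sigma>r b by (simp add: src.S.m_assoc tgt.S.m_assoc)
    qed
    have "extension (b \<otimes>\<^bsub>S\<^esub> l r \<otimes>\<^bsub>S\<^esub> x j) = extension (b \<otimes>\<^bsub>S\<^esub> (l r \<otimes>\<^bsub>S\<^esub> x j))"
      using b xj monomial(2) by (simp add: src.S.m_assoc)
    also have "\<dots> = extension ((\<Oplus>\<^bsub>S\<^esub>i\<in>{1..n}. b \<otimes>\<^bsub>S\<^esub> (x i \<otimes>\<^bsub>S\<^esub> l (\<sigma> r (i, j)))) \<oplus>\<^bsub>S\<^esub> b \<otimes>\<^bsub>S\<^esub> l (\<delta> r j))"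
      using rel_x j monomial(2) sumS \<delta>r b xi \<sigma>r
      by (simp add: skew_relations_def src.S.r_distr src.S.finsum_rdistr Pi_iff)
    also have "\<dots> = (\<Oplus>\<^bsub>A\<^esub>i\<in>{1..n}. extension (b \<otimes>\<^bsub>S\<^esub> (x i \<otimes>\<^bsub>S\<^esub> l (\<sigma> r (i, j))))) \<oplus>\<^bsub>A\<^esub> g b \<otimes>\<^bsub>A\<^esub> m (\<delta> r j)"
      using sumS' \<delta>r b xi \<sigma>r monomial(1)
      by (simp add: extension_add extension_right_mult extension_basis ext.hom_finsum_additive Pi_iff)
    also have "(\<Oplus>\<^bsub>A\<^esub>i\<in>{1..n}. extension (b \<otimes>\<^bsub>S\<^esub> (x i \<otimes>\<^bsub>S\<^esub> l (\<sigma> r (i, j))))) =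
        (\<Oplus>\<^bsub>A\<^esub>i\<in>{1..n}. g b \<otimes>\<^bsub>A\<^esub> (a i \<otimes>\<^bsub>A\<^esub> m (\<sigma> r (i, j))))"
      using b xi \<sigma>r by (intro tgt.S.finsum_cong') (auto simp: ext_term)
    \<comment> \<open>The relation in \<open>A\<close> is now read from right to left and
      reassembles \<open>m r \<otimes> a j\<close>.\<close>
    also have "\<dots> \<oplus>\<^bsub>A\<^esub> g b \<otimes>\<^bsub>A\<^esub> m (\<delta> r j) = g b \<otimes>\<^bsub>A\<^esub> (m r \<otimes>\<^bsub>A\<^esub> a j)"
      using rel_a j monomial(2) sumA \<delta>r b xi \<sigma>r
      by (simp add: skew_relations_def tgt.S.r_distr tgt.S.finsum_rdistr Pi_iff)
    also have "\<dots> = extension (b \<otimes>\<^bsub>S\<^esub> l r) \<otimes>\<^bsub>A\<^esub> a j"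
      using b xj monomial by (simp add: tgt.S.m_assoc extension_right_mult extension_basis)
    finally show ?case .
  qed
  \<comment> \<open>Quantifying over all left factors \<open>s\<close> makes closure under products
    a matter of rebracketing \<open>s \<otimes> (t \<otimes> t')\<close>.\<close>
  define T where "T = {t \<in> carrier S. \<forall>s\<in>carrier S. extension (s \<otimes>\<^bsub>S\<^esub> t) = extension s \<otimes>\<^bsub>A\<^esub> extension t}"
  have "submonoid T S"
  proof
    show "s \<otimes>\<^bsub>S\<^esub> t \<in> T" if "s \<in> T" "t \<in> T" for s t
      using that by (auto simp: T_def src.S.m_assoc[symmetric] tgt.S.m_assoc)
  qed (auto simp: T_def one)
  moreover have "X \<subseteq> T"
    using X by (auto simp: X_def T_def mult_x ext_x)
  ultimately have "B \<subseteq> T"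
    unfolding B_def by (rule generated_submonoid_minimal)
  have "t \<in> T" if "t \<in> carrier S" for t
    using S basis that
  proof (induction rule: right_basis_induct)
    case (monomial b r)
    \<comment> \<open>Membership of \<open>l r\<close> is right linearity together with
      \<open>ext_l\<close>.\<close>
    then have "b \<in> T" "l r \<in> T"
      using \<open>B \<subseteq> T\<close> by (auto simp: T_def extension_right_mult ext_l)
    then show ?case
      using \<open>submonoid T S\<close> by (intro submonoid.m_closed)
  qed (auto simp: T_def src.S.r_distr tgt.S.r_distr extension_add)
  then have "extension \<in> ring_hom S A"
    by (intro ring_hom_memI) (auto simp: T_def one extension_add)
  then have "extension \<in> Rring_hom R S l A m"
    by (simp add: Rring_hom_def ext_l extension_extensional)
  then show ?thesis
    using ext_x by blast
qed

text \<open>The type \<open>'a\<close> of the test rings is independent of the type of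
  \<open>S\<close>, so the property can later be instantiated at the types of both
  extensions.\<close>

lemma free_skew_extension_universal:
  assumes "\<sigma> \<in> carrier R \<rightarrow> ({1..n} \<times> {1..n} \<rightarrow> carrier R)"
    and "\<delta> \<in> carrier R \<rightarrow> ({1..n} \<rightarrow> carrier R)"
    and free: "free_skew_extension R n \<sigma> \<delta> S l x"
  shows "universal_property TYPE('a) R n \<sigma> \<delta> S l x"
  unfolding universal_property_def
proof (intro allI impI, elim conjE)
  fix A :: "'a ring" and m a
  assume A: "ring_hom_ring R A m" "a \<in> {1..n} \<rightarrow> carrier A" "skew_relations R n \<sigma> \<delta> A m a"
  have S: "ring_hom_ring R S l" "right_basis R S l (generated_submonoid S (x ` {1..n}))"
    "x ` {1..n} \<subseteq> carrier S"
    using free by (auto simp: free_skew_extension_def)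
  have "ring A"
    using A(1) by (simp add: ring_hom_ring_def)
  show "\<exists>!\<psi>. \<psi> \<in> Rring_hom R S l A m \<and> (\<forall>i\<in>{1..n}. \<psi> (x i) = a i)"
  proof (rule ex_ex1I)
    show "\<exists>\<psi>. \<psi> \<in> Rring_hom R S l A m \<and> (\<forall>i\<in>{1..n}. \<psi> (x i) = a i)"
      using assms A by (rule free_skew_extension_hom_exists)
    show "\<phi> = \<psi>" if "\<phi> \<in> Rring_hom R S l A m \<and> (\<forall>i\<in>{1..n}. \<phi> (x i) = a i)"
      "\<psi> \<in> Rring_hom R S l A m \<and> (\<forall>i\<in>{1..n}. \<psi> (x i) = a i)" for \<phi> \<psi>
      by (rule Rring_hom_unique[OF S(1) \<open>ring A\<close> S(2,3)]) (use that in auto)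
  qed
qed

section \<open>Uniqueness of universal objects\<close>

text \<open>\<open>compose\<close> instead of plain composition keeps the composite extensional on
  the carrier of \<open>A\<close>.\<close>

lemma Rring_hom_compose:
  assumes "ring_hom_ring R A lA" "\<phi> \<in> Rring_hom R A lA B lB" "\<psi> \<in> Rring_hom R B lB C lC"
  shows "compose (carrier A) \<psi> \<phi> \<in> Rring_hom R A lA C lC"
proof -
  interpret ring_hom_ring R A lA by fact
  show ?thesis
    using assms(2,3) by (auto simp: Rring_hom_def ring_hom_def compose_def Pi_iff)
qed

lemma Rring_hom_id:
  assumes "ring_hom_ring R A lA"
  shows "(\<lambda>s\<in>carrier A. s) \<in> Rring_hom R A lA A lA"
proof -
  interpret ring_hom_ring R A lA by fact
  show ?thesis
    by (auto simp: Rring_hom_def ring_hom_def)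
qed

text \<open>The round trip and the identity are both endomorphisms of \<open>S\<close> over
  \<open>R\<close> fixing every \<open>x i\<close>. Testing the universal property against
  \<open>S\<close> itself, hence at the type \<open>'a\<close>, identifies them.\<close>

lemma universal_property_retract:
  fixes S :: "'a ring" and S' :: "'b ring"
  assumes S: "ring_hom_ring R S l" "x \<in> {1..n} \<rightarrow> carrier S" "skew_relations R n \<sigma> \<delta> S l x"
    and univ: "universal_property TYPE('a) R n \<sigma> \<delta> S l x"
    and \<phi>: "\<phi> \<in> Rring_hom R S l S' l'" "\<forall>i\<in>{1..n}. \<phi> (x i) = y i"
    and \<psi>: "\<psi> \<in> Rring_hom R S' l' S l" "\<forall>i\<in>{1..n}. \<psi> (y i) = x i"
    and s: "s \<in> carrier S"
  shows "\<psi> (\<phi> s) = s"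
proof -
  have "\<exists>!\<theta>. \<theta> \<in> Rring_hom R S l S l \<and> (\<forall>i\<in>{1..n}. \<theta> (x i) = x i)"
    using univ S unfolding universal_property_def by blast
  moreover have "compose (carrier S) \<psi> \<phi> \<in> Rring_hom R S l S l"
    using S(1) \<phi>(1) \<psi>(1) by (rule Rring_hom_compose)
  moreover have "\<forall>i\<in>{1..n}. compose (carrier S) \<psi> \<phi> (x i) = x i"
    using S(2) \<phi>(2) \<psi>(2) by (auto simp: compose_def)
  moreover have "(\<lambda>s\<in>carrier S. s) \<in> Rring_hom R S l S l"
    using S(1) by (rule Rring_hom_id)
  moreover have "\<forall>i\<in>{1..n}. (\<lambda>s\<in>carrier S. s) (x i) = x i"
    using S(2) by auto
  ultimately have "compose (carrier S) \<psi> \<phi> = (\<lambda>s\<in>carrier S. s)"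
    by blast
  then show ?thesis
    using s by (metis compose_eq restrict_apply')
qed

text \<open>Each object is tested at both types: at the type of the other object to obtain the maps
  \<open>\<phi>\<close> and \<open>\<psi>\<close>, at its own type to see that they are mutually
  inverse. Uniqueness is inherited from homomorphisms, as every isomorphism is one.\<close>

lemma universal_property_iso:
  fixes S1 :: "'a ring" and S2 :: "'b ring"
  assumes S1: "ring_hom_ring R S1 l1" "x \<in> {1..n} \<rightarrow> carrier S1" "skew_relations R n \<sigma> \<delta> S1 l1 x"
    and S2: "ring_hom_ring R S2 l2" "y \<in> {1..n} \<rightarrow> carrier S2" "skew_relations R n \<sigma> \<delta> S2 l2 y"
    and univ1: "universal_property TYPE('a) R n \<sigma> \<delta> S1 l1 x"
      "universal_property TYPE('b) R n \<sigma> \<delta> S1 l1 x"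
    and univ2: "universal_property TYPE('a) R n \<sigma> \<delta> S2 l2 y"
      "universal_property TYPE('b) R n \<sigma> \<delta> S2 l2 y"
  shows "\<exists>!\<phi>. \<phi> \<in> Rring_iso R S1 l1 S2 l2 \<and> (\<forall>i\<in>{1..n}. \<phi> (x i) = y i)"
proof -
  have ex1: "\<exists>!\<phi>. \<phi> \<in> Rring_hom R S1 l1 S2 l2 \<and> (\<forall>i\<in>{1..n}. \<phi> (x i) = y i)"
    using univ1(2) S2 unfolding universal_property_def by blast
  then obtain \<phi> where \<phi>: "\<phi> \<in> Rring_hom R S1 l1 S2 l2" "\<forall>i\<in>{1..n}. \<phi> (x i) = y i"
    by blast
  have "\<exists>!\<psi>. \<psi> \<in> Rring_hom R S2 l2 S1 l1 \<and> (\<forall>i\<in>{1..n}. \<psi> (y i) = x i)"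
    using univ2(1) S1 unfolding universal_property_def by blast
  then obtain \<psi> where \<psi>: "\<psi> \<in> Rring_hom R S2 l2 S1 l1" "\<forall>i\<in>{1..n}. \<psi> (y i) = x i"
    by blast
  have "bij_betw \<phi> (carrier S1) (carrier S2)"
  proof (rule bij_betw_byWitness)
    show "\<forall>s\<in>carrier S1. \<psi> (\<phi> s) = s"
      using universal_property_retract[OF S1 univ1(1) \<phi> \<psi>] by blast
    show "\<forall>s\<in>carrier S2. \<phi> (\<psi> s) = s"
      using universal_property_retract[OF S2 univ2(2) \<psi> \<phi>] by blast
  qed (use \<phi>(1) \<psi>(1) in \<open>auto simp: Rring_hom_def ring_hom_def\<close>)
  then have "\<phi> \<in> Rring_iso R S1 l1 S2 l2"
    using \<phi>(1) by (simp add: Rring_iso_def Rring_hom_def ring_iso_def)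
  then show ?thesis
    using ex1 \<phi>(2) unfolding Rring_iso_def by blast
qed

theorem corollary1p3:
  fixes R :: "'r ring" and n :: nat
    and \<sigma> :: "'r \<Rightarrow> nat \<times> nat \<Rightarrow> 'r" and \<delta> :: "'r \<Rightarrow> nat \<Rightarrow> 'r"
    and S1 :: "'a ring" and l1 :: "'r \<Rightarrow> 'a" and x :: "nat \<Rightarrow> 'a"
  assumes "ring R" and "n > 0"
    and "\<sigma> \<in> ring_hom R (matrix_ring R n)"
    and "right_derivation R n \<sigma> \<delta>"
    and "free_skew_extension R n \<sigma> \<delta> S1 l1 x"
  shows
    "(\<forall>(S2 :: 'b ring) l2 y.
        ring_hom_ring R S2 l2 \<and> y \<in> {1..n} \<rightarrow> carrier S2 \<and>
        skew_relations R n \<sigma> \<delta> S2 l2 y \<and>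
        universal_property TYPE('a) R n \<sigma> \<delta> S2 l2 y \<and>
        universal_property TYPE('b) R n \<sigma> \<delta> S2 l2 y \<longrightarrow>
        (\<exists>\<phi>\<in>Rring_iso R S1 l1 S2 l2. \<forall>i\<in>{1..n}. \<phi> (x i) = y i)) \<and>
     (\<forall>(S2 :: 'b ring) l2 y.
        free_skew_extension R n \<sigma> \<delta> S2 l2 y \<longrightarrow>
        (\<exists>!\<phi>. \<phi> \<in> Rring_iso R S1 l1 S2 l2 \<and> (\<forall>i\<in>{1..n}. \<phi> (x i) = y i)))"
proof -
  have \<sigma>: "\<sigma> \<in> carrier R \<rightarrow> ({1..n} \<times> {1..n} \<rightarrow> carrier R)"
    using assms(3) by (auto simp: ring_hom_def matrix_ring_def Pi_iff PiE_iff)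
  have \<delta>: "\<delta> \<in> carrier R \<rightarrow> ({1..n} \<rightarrow> carrier R)"
    using assms(4) by (auto simp: right_derivation_def Pi_iff PiE_iff)
  \<comment> \<open>The extension and the test type both stay schematic: the fact is used for
    \<open>S1\<close> and for a second free extension, each at \<open>'a\<close> and at
    \<open>'b\<close>.\<close>
  note universal = free_skew_extension_universal[OF \<sigma> \<delta>]
  have S1: "ring_hom_ring R S1 l1" "x \<in> {1..n} \<rightarrow> carrier S1" "skew_relations R n \<sigma> \<delta> S1 l1 x"
    using assms(5) by (simp_all add: free_skew_extension_def)
  have iso: "\<exists>!\<phi>. \<phi> \<in> Rring_iso R S1 l1 S2 l2 \<and> (\<forall>i\<in>{1..n}. \<phi> (x i) = y i)"
    if "ring_hom_ring R S2 l2" "y \<in> {1..n} \<rightarrow> carrier S2" "skew_relations R n \<sigma> \<delta> S2 l2 y"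
      "universal_property TYPE('a) R n \<sigma> \<delta> S2 l2 y"
      "universal_property TYPE('b) R n \<sigma> \<delta> S2 l2 y" for S2 :: "'b ring" and l2 y
    using S1 that(1-3) universal[OF assms(5)] universal[OF assms(5)] that(4,5)
    by (rule universal_property_iso)
  show ?thesis
  proof (intro conjI allI impI, elim conjE)
    fix S2 :: "'b ring" and l2 y
    assume "ring_hom_ring R S2 l2" "y \<in> {1..n} \<rightarrow> carrier S2" "skew_relations R n \<sigma> \<delta> S2 l2 y"
      "universal_property TYPE('a) R n \<sigma> \<delta> S2 l2 y" "universal_property TYPE('b) R n \<sigma> \<delta> S2 l2 y"
    then show "\<exists>\<phi>\<in>Rring_iso R S1 l1 S2 l2. \<forall>i\<in>{1..n}. \<phi> (x i) = y i"
      using iso by blast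
  next
    fix S2 :: "'b ring" and l2 y
    assume free2: "free_skew_extension R n \<sigma> \<delta> S2 l2 y"
    show "\<exists>!\<phi>. \<phi> \<in> Rring_iso R S1 l1 S2 l2 \<and> (\<forall>i\<in>{1..n}. \<phi> (x i) = y i)"
      \<comment> \<open>A second free extension is universal as well, so the case of a universal
        \<open>S2\<close> applies.\<close>
      by (intro iso universal free2) (use free2 in \<open>simp_all add: free_skew_extension_def\<close>)
  qed
qed

end
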